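(* Let $q$ be a prime power, let $n \in \mathbb{Z}^+$, and let $a$ be an integer with $0 \le a < q$. Then every partial cover of $\mathrm{PG}(n,q)$ of size $q+a$ has at least $q^{n-1} - a q^{n-2}$ holes.
   Context: $\mathrm{PG}(n,q)$ is the $n$-dimensional projective space over the finite field $\mathbb{F}_q$. A partial cover of $\mathrm{PG}(n,q)$ is a set of hyperplanes of $\mathrm{PG}(n,q)$ whose union is not all of the points of $\mathrm{PG}(n,q)$; its size is the number of hyperplanes in it. The points not lying on any hyperplane of the partial cover are called its holes. *)

theory Defs
  imports "HOL-Analysis.Cartesian_Space"
begin

text \<open>
  \<open>PG(n,q)\<close> is the projective space of the vector space \<^typ>\<open>'a ^ 'm\<close> over a finite field
  \<^typ>\<open>'a\<close> with \<open>CARD('a) = q\<close> and \<open>CARD('m) = n + 1\<close>: its points are the subspaces of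
  vector space dimension 1, and a hyperplane is the set of all points contained in a subspace
  of vector space dimension \<open>n\<close>.
\<close>

definition pg_points :: "('a::field ^ 'm::finite) set set" where
  "pg_points = {P. vec.subspace P \<and> vec.dim P = 1}"

definition pg_hyperplanes :: "('a::field ^ 'm::finite) set set set" where
  "pg_hyperplanes =
    {{P \<in> pg_points. P \<subseteq> W} | W :: ('a ^ 'm) set. vec.subspace W \<and> vec.dim W + 1 = CARD('m)}"

definition partial_cover :: "('a::field ^ 'm::finite) set set set \<Rightarrow> bool" where
  "partial_cover C \<longleftrightarrow> C \<subseteq> pg_hyperplanes \<and> \<Union>C \<noteq> pg_points"

definition holes :: "('a::field ^ 'm::finite) set set set \<Rightarrow> ('a ^ 'm) set set" where
  "holes C = pg_points - \<Union>C"

end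

theory Submission
  imports Defs
begin

text \<open>
  Take one hyperplane of the cover to infinity. The holes are the points of the remaining affine
  space \<open>AG(n,q)\<close> where the product \<open>f\<close> of the \<open>q + a - 1\<close> other linear forms does not vanish, so the
  claim is an instance of the minimum distance bound for generalised Reed-Muller codes. That bound
  follows by induction on \<open>n\<close>: if \<open>f\<close> vanishes on exactly \<open>k\<close> of the \<open>q\<close> slices \<open>x\<^sub>i = c\<close>, then \<open>f\<close> is
  the product of the \<open>k\<close> factors \<open>x\<^sub>i - c\<close> and a polynomial whose degree is smaller by \<open>k\<close>, which is
  not identically zero on any of the other \<open>q - k\<close> slices.
\<close>

section \<open>Polynomial functions of bounded degree and division by coordinate slices\<close>

definition affine_fun :: "(('i::finite \<Rightarrow> 'a::field) \<Rightarrow> 'a) \<Rightarrow> bool" where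
  "affine_fun l \<longleftrightarrow> (\<exists>k w. \<forall>x. l x = k + (\<Sum>i\<in>UNIV. w i * x i))"

text \<open>
  Stands for polynomial functions of degree less than \<open>d\<close>, by means of divided differences in
  the coordinate directions. With this definition a function vanishing on a slice can be divided by
  the equation of the slice without any reference to monomials.
\<close>

primrec deg_less :: "nat \<Rightarrow> (('i \<Rightarrow> 'a::field) \<Rightarrow> 'a) \<Rightarrow> bool" where
  "deg_less 0 f \<longleftrightarrow> (\<forall>x. f x = 0)"
| "deg_less (Suc d) f \<longleftrightarrow>
    (\<forall>i c. \<exists>g. deg_less d g \<and> (\<forall>x. f x = f (x(i := c)) + (x i - c) * g x))"

text \<open>Freezing the coordinates outside \<open>J\<close> keeps flats of every dimension in one
  function type, so that the induction on the dimension can run over \<open>J\<close>.\<close>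

definition coord_flat :: "'i set \<Rightarrow> ('i \<Rightarrow> 'a) \<Rightarrow> ('i \<Rightarrow> 'a) set" where
  "coord_flat J u = {x. \<forall>i. i \<notin> J \<longrightarrow> x i = u i}"

definition nonzeros :: "(('i \<Rightarrow> 'a::zero) \<Rightarrow> 'a) \<Rightarrow> 'i set \<Rightarrow> ('i \<Rightarrow> 'a) \<Rightarrow> ('i \<Rightarrow> 'a) set" where
  "nonzeros f J u = {x \<in> coord_flat J u. f x \<noteq> 0}"

lemma sum_fun_upd:
  fixes w x :: "'i::finite \<Rightarrow> 'a::field"
  shows "(\<Sum>j\<in>UNIV. w j * x j) = (\<Sum>j\<in>UNIV. w j * (x(i := c)) j) + w i * (x i - c)"
proof -
  have "(\<Sum>j\<in>UNIV. w j * y j) = w i * y i + (\<Sum>j\<in>UNIV - {i}. w j * y j)" for y :: "'i \<Rightarrow> 'a"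
    by (simp add: sum.remove)
  from this[of x] this[of "x(i := c)"] show ?thesis
    by (simp add: algebra_simps)
qed

lemma affine_fun_slice:
  assumes "affine_fun l"
  shows "\<exists>b. \<forall>x. l x = l (x(i := c)) + (x i - c) * b"
    and "affine_fun (\<lambda>x. l (x(i := c)))"
proof -
  obtain k w where l: "\<And>x. l x = k + (\<Sum>j\<in>UNIV. w j * x j)"
    using assms by (auto simp: affine_fun_def)
  have *: "l x = l (x(i := c)) + (x i - c) * w i" for x
    using sum_fun_upd[of w x i c] by (simp add: l algebra_simps)
  then show "\<exists>b. \<forall>x. l x = l (x(i := c)) + (x i - c) * b" by blast
  have "(\<Sum>j\<in>UNIV. (w(i := 0)) j * x j) = (\<Sum>j\<in>UNIV. w j * x j) - w i * x i" for x
    by (simp add: sum.remove[of UNIV i])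
  moreover have "l (x(i := c)) = (k + w i * c) + ((\<Sum>j\<in>UNIV. w j * x j) - w i * x i)" for x
  proof -
    have "l (x(i := c)) = l x - (x i - c) * w i"
      using *[of x] by (metis add_diff_cancel_right')
    then show ?thesis by (simp add: l[of x] algebra_simps)
  qed
  ultimately have "l (x(i := c)) = (k + w i * c) + (\<Sum>j\<in>UNIV. (w(i := 0)) j * x j)" for x
    by metis
  then show "affine_fun (\<lambda>x. l (x(i := c)))"
    unfolding affine_fun_def by blast
qed

lemma deg_less_zero: "deg_less d (\<lambda>x. 0)"
  by (induction d) auto

lemma deg_less_const: "deg_less (Suc d) (\<lambda>x. c)"
  using deg_less_zero by fastforce

lemma deg_less_scale: "deg_less d f \<Longrightarrow> deg_less d (\<lambda>x. b * f x)"
proof (induction d arbitrary: f)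
  case 0
  then show ?case by simp
next
  case (Suc d)
  show ?case
    unfolding deg_less.simps
  proof (intro allI)
    fix i c
    obtain g where "deg_less d g" and f: "\<And>x. f x = f (x(i := c)) + (x i - c) * g x"
      using Suc.prems by (metis deg_less.simps(2))
    moreover have "b * f x = b * f (x(i := c)) + (x i - c) * (b * g x)" for x
      by (subst f) (simp add: algebra_simps)
    ultimately show "\<exists>g. deg_less d g \<and> (\<forall>x. b * f x = b * f (x(i := c)) + (x i - c) * g x)"
      using Suc.IH by blast
  qed
qed

lemma deg_less_add: "deg_less d f \<Longrightarrow> deg_less d f' \<Longrightarrow> deg_less d (\<lambda>x. f x + f' x)"
proof (induction d arbitrary: f f')
  case 0
  then show ?case by simp
next
  case (Suc d)
  show ?case
    unfolding deg_less.simps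
  proof (intro allI)
    fix i c
    obtain g where "deg_less d g" and f: "\<And>x. f x = f (x(i := c)) + (x i - c) * g x"
      using Suc.prems(1) by (metis deg_less.simps(2))
    moreover obtain g' where "deg_less d g'" and f': "\<And>x. f' x = f' (x(i := c)) + (x i - c) * g' x"
      using Suc.prems(2) by (metis deg_less.simps(2))
    moreover have "f x + f' x = f (x(i := c)) + f' (x(i := c)) + (x i - c) * (g x + g' x)" for x
      by (subst f, subst f') (simp add: algebra_simps)
    ultimately show "\<exists>g. deg_less d g \<and>
        (\<forall>x. f x + f' x = f (x(i := c)) + f' (x(i := c)) + (x i - c) * g x)"
      using Suc.IH by blast
  qed
qed

text \<open>The product rule for divided differences: the quotient for \<open>l * f\<close> is
  \<open>b * f + l' * g\<close>, where \<open>l'\<close> is \<open>l\<close> with \<open>x i\<close>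
  set to \<open>c\<close>. As \<open>l'\<close> is affine again but differs from \<open>l\<close>,
  the induction has to keep \<open>l\<close> arbitrary.\<close>

lemma deg_less_affine_mult:
  "deg_less d f \<Longrightarrow> affine_fun l \<Longrightarrow> deg_less (Suc d) (\<lambda>x. l x * f x)"
proof (induction d arbitrary: f l)
  case 0
  then have "(\<lambda>x. l x * f x) = (\<lambda>x. 0)" by simp
  then show ?case by (metis deg_less_zero)
next
  case (Suc d)
  show ?case
    unfolding deg_less.simps(2)[of "Suc d"]
  proof (intro allI)
    fix i c
    obtain g where g: "deg_less d g" and f: "\<And>x. f x = f (x(i := c)) + (x i - c) * g x"
      using Suc.prems(1) by (metis deg_less.simps(2))
    obtain b where l: "\<And>x. l x = l (x(i := c)) + (x i - c) * b"
      using affine_fun_slice(1)[OF Suc.prems(2)] by metis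
    have "deg_less (Suc d) (\<lambda>x. b * f x + l (x(i := c)) * g x)"
      by (intro deg_less_add deg_less_scale Suc.prems(1) Suc.IH g affine_fun_slice(2) Suc.prems(2))
    moreover have "l x * f x = l (x(i := c)) * f (x(i := c))
        + (x i - c) * (b * f x + l (x(i := c)) * g x)" for x
    proof -
      have "l x * f x = l (x(i := c)) * f x + (x i - c) * b * f x"
        by (subst l) (simp add: algebra_simps)
      also have "l (x(i := c)) * f x = l (x(i := c)) * (f (x(i := c)) + (x i - c) * g x)"
        by (subst f) simp
      finally show ?thesis by (simp add: algebra_simps)
    qed
    ultimately show "\<exists>g. deg_less (Suc d) g \<and>
        (\<forall>x. l x * f x = l (x(i := c)) * f (x(i := c)) + (x i - c) * g x)"
      by blast
  qed
qed

lemma deg_less_prod: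
  assumes "finite S" and "\<And>s. s \<in> S \<Longrightarrow> affine_fun (l s)"
  shows "deg_less (Suc (card S)) (\<lambda>x. \<Prod>s\<in>S. l s x)"
  using assms
proof (induction S)
  case empty
  then show ?case using deg_less_const[of 0 1] by (simp del: deg_less.simps)
next
  case (insert s S)
  then show ?case using deg_less_affine_mult[of "Suc (card S)" "\<lambda>x. \<Prod>s\<in>S. l s x" "l s"] by simp
qed

text \<open>Linear factors are split off one at a time. On the slice \<open>x i = c\<close> the
  factors found before are nonzero, so the cofactor vanishes there and its divided difference at
  \<open>c\<close> is the next cofactor. The point \<open>x0\<close> keeps the cofactor from being
  zero, whence \<open>card K < d\<close>.\<close>

lemma deg_less_factor:
  assumes "finite K" and "deg_less d f" and "x0 \<in> coord_flat (insert i J) u" and "f x0 \<noteq> 0"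
    and "\<And>c x. c \<in> K \<Longrightarrow> x \<in> coord_flat J (u(i := c)) \<Longrightarrow> f x = 0" and "i \<notin> J"
  shows "card K < d \<and> (\<exists>g. deg_less (d - card K) g \<and>
    (\<forall>x\<in>coord_flat (insert i J) u. f x = (\<Prod>c\<in>K. x i - c) * g x))"
  using assms(1,5)
proof (induction K)
  case empty
  have "d \<noteq> 0" using assms(2,4) by (cases d) auto
  then show ?case using assms(2) by auto
next
  case (insert c K)
  have "card K < d \<and> (\<exists>g. deg_less (d - card K) g \<and>
      (\<forall>x\<in>coord_flat (insert i J) u. f x = (\<Prod>c\<in>K. x i - c) * g x))"
    using insert.IH insert.prems by blast
  then obtain g where K: "card K < d" and g: "deg_less (d - card K) g"
    and f: "\<And>x. x \<in> coord_flat (insert i J) u \<Longrightarrow> f x = (\<Prod>c\<in>K. x i - c) * g x"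
    by blast
  obtain e where e: "d - card K = Suc e"
    using K by (metis Suc_diff_Suc)
  obtain g' where g': "deg_less e g'" and gg': "\<And>x. g x = g (x(i := c)) + (x i - c) * g' x"
    using g unfolding e deg_less.simps by metis
  have f': "f x = (\<Prod>c\<in>insert c K. x i - c) * g' x" if x: "x \<in> coord_flat (insert i J) u" for x
  proof -
    let ?y = "x(i := c)"
    have y: "?y \<in> coord_flat (insert i J) u" "?y \<in> coord_flat J (u(i := c))"
      using x by (auto simp: coord_flat_def)
    have "(\<Prod>c\<in>K. ?y i - c) * g ?y = 0"
      using insert.prems[of c ?y, OF insertI1 y(2)] f[OF y(1)] by argo
    moreover have "(\<Prod>c\<in>K. ?y i - c) \<noteq> 0"
      using insert.hyps by auto
    ultimately have "g ?y = 0" by simp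
    then show ?thesis
      using f[OF x] gg'[of x] insert.hyps by (simp add: algebra_simps)
  qed
  have "e \<noteq> 0"
  proof
    assume "e = 0"
    then have "f x0 = 0" using f'[OF assms(3)] g' by simp
    then show False using assms(4) by simp
  qed
  moreover have "d - card (insert c K) = e"
    using e insert.hyps by simp
  ultimately show ?case
    using g' f' e insert.hyps by fastforce
qed

section \<open>The minimum distance bound for functions on flats\<close>

text \<open>
  For \<open>n \<ge> 2\<close> and \<open>1 \<le> d < 2 q\<close>, this is the minimum distance of the Reed-Muller code of
  \<open>n\<close>-variate polynomials of degree less than \<open>d\<close>, divided by \<open>q ^ (n - 2)\<close>.
\<close>

definition rm_bound :: "nat \<Rightarrow> nat \<Rightarrow> nat" where
  "rm_bound q d = (if d \<le> q then q * (q + 1 - d) else 2 * q - d)"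

lemma rm_bound_le:
  assumes "d > 0" "q > 0"
  shows "rm_bound q d \<le> q\<^sup>2"
proof (cases "d \<le> q")
  case True
  then show ?thesis using assms by (simp add: rm_bound_def power2_eq_square)
next
  case False
  obtain m where "q = Suc m" using assms(2) gr0_implies_Suc by blast
  with False show ?thesis by (simp add: rm_bound_def power2_eq_square)
qed

text \<open>The arithmetic of discarding \<open>k\<close> slices: the other \<open>q - k\<close>
  slices, each with the degree bound lowered by \<open>k\<close>, must together yield the bound one
  dimension higher. The cases depend on where \<open>d\<close> and \<open>s = d - k\<close> lie
  relative to \<open>q\<close>.\<close>

lemma rm_bound_step:
  assumes "k < d" "k < q"
  shows "q * rm_bound q d \<le> (q - k) * rm_bound q (d - k)"
proof -
  obtain r where q: "q = k + r" and r: "r \<ge> 1"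
    using assms(2) by (metis less_imp_add_positive Suc_leI One_nat_def)
  obtain s where d: "d = k + s" and s: "s \<ge> 1"
    using assms(1) by (metis less_imp_add_positive Suc_leI One_nat_def)
  consider "d \<le> q" | "d > q" "s \<le> q" | "s > q" by linarith
  then show ?thesis
  proof cases
    case 1
    then obtain t where t: "r = s + t" using q d le_Suc_ex by auto
    have "rm_bound q d = q * (t + 1)" "rm_bound q (d - k) = q * (k + t + 1)"
      using q d t by (auto simp: rm_bound_def)
    \<comment> \<open>The right side exceeds the left by \<open>k * (s - 1)\<close>.\<close>
    moreover have "q * (t + 1) \<le> r * (k + t + 1)"
      using q t s by (simp add: algebra_simps)
    ultimately show ?thesis using mult_le_mono2[of "q * (t + 1)" "r * (k + t + 1)" q] q
      by (metis add_diff_cancel_left' mult.left_commute)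
  next
    case 2
    then obtain t where t: "q = s + t" using le_Suc_ex by auto
    have *: "rm_bound q d = 2 * q - d" "rm_bound q (d - k) = q * (t + 1)"
      using 2 d t by (auto simp: rm_bound_def)
    have "2 * q - d = r + t" using q d t by simp
    moreover have "r + t \<le> r * (t + 1)"
    proof -
      have "t \<le> r * t" using r by simp
      then show ?thesis by (simp add: algebra_simps)
    qed
    ultimately show ?thesis using mult_le_mono2[of "r + t" "r * (t + 1)" q] q *
      by (metis add_diff_cancel_left' mult.left_commute)
  next
    case 3
    show ?thesis
    proof (cases "2 * q \<le> d")
      \<comment> \<open>Truncated subtraction makes the left side 0.\<close>
      case True
      then show ?thesis using 3 by (simp add: rm_bound_def d)
    next
      case False
      then obtain t where t: "2 * q = d + t" using le_Suc_ex by (metis nat_le_linear)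
      have *: "rm_bound q d = t" "rm_bound q (d - k) = t + k"
        using 3 d t by (auto simp: rm_bound_def)
      have "t \<le> r" using t q d 3 by simp
      then have "k * t \<le> k * r" by simp
      then show ?thesis using q * by (simp add: algebra_simps)
    qed
  qed
qed

text \<open>The square on the right replaces the exponent \<open>card J - 2\<close>, so that the
  induction can start from a single point, with \<open>J\<close> empty.\<close>

lemma nonzeros_lower_bound:
  fixes f :: "('i::finite \<Rightarrow> 'a::{field,finite}) \<Rightarrow> 'a"
  assumes "deg_less d f" and "nonzeros f J u \<noteq> {}"
  shows "CARD('a) ^ card J * rm_bound CARD('a) d \<le> card (nonzeros f J u) * CARD('a)\<^sup>2"
proof -
  let ?q = "CARD('a)"
  have "finite J" by simp
  then show ?thesis using assms
  proof (induction J arbitrary: u f d)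
    case empty
    then have "d \<noteq> 0" by (cases d) (auto simp: nonzeros_def)
    then have "rm_bound ?q d \<le> ?q\<^sup>2"
      using rm_bound_le[of d ?q] by simp
    moreover have "card (nonzeros f {} u) \<ge> 1"
      using empty.prems(2) by (simp add: Suc_leI card_gt_0_iff)
    ultimately show ?case
      using mult_le_mono[of 1 "card (nonzeros f {} u)" "rm_bound ?q d"] by simp
  next
    case (insert i J)
    define K where "K = {c. \<forall>x\<in>coord_flat J (u(i := c)). f x = 0}"
    obtain x0 where x0: "x0 \<in> coord_flat (insert i J) u" "f x0 \<noteq> 0"
      using insert.prems(2) by (auto simp: nonzeros_def)
    obtain g where Kd: "card K < d" and g: "deg_less (d - card K) g"
      and f: "\<And>x. x \<in> coord_flat (insert i J) u \<Longrightarrow> f x = (\<Prod>c\<in>K. x i - c) * g x"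
      using deg_less_factor[OF finite insert.prems(1) x0 _ insert.hyps(2), of K]
      unfolding K_def by blast
    have "x0 \<in> coord_flat J (u(i := x0 i))"
      using x0 by (auto simp: coord_flat_def)
    then have "K \<noteq> UNIV" using x0 by (auto simp: K_def)
    then have Kq: "card K < ?q" by (simp add: psubset_card_mono psubsetI)
    have sub: "coord_flat J (u(i := c)) \<subseteq> coord_flat (insert i J) u" for c
      using insert.hyps by (auto simp: coord_flat_def)
    have at_i: "x i = c" if "x \<in> coord_flat J (u(i := c))" for x c
      using that insert.hyps by (auto simp: coord_flat_def)
    \<comment> \<open>On a slice outside \<open>K\<close> the split-off product is a nonzero
      constant. So \<open>f\<close> may be exchanged for \<open>g\<close>, to which the induction
      hypothesis applies with the smaller degree.\<close>
    have eq: "nonzeros g J (u(i := c)) = nonzeros f J (u(i := c))" if "c \<notin> K" for c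
      using f sub at_i that by (fastforce simp: nonzeros_def)
    have slice: "?q ^ card J * rm_bound ?q (d - card K) \<le> card (nonzeros f J (u(i := c))) * ?q\<^sup>2"
      if "c \<in> - K" for c
    proof -
      have "nonzeros f J (u(i := c)) \<noteq> {}"
        using that by (auto simp: K_def nonzeros_def)
      then show ?thesis
        using insert.IH[OF g, of "u(i := c)"] that unfolding eq[OF that[simplified]] by blast
    qed
    have "?q ^ card (insert i J) * rm_bound ?q d = ?q ^ card J * (?q * rm_bound ?q d)"
      using insert.hyps by simp
    also have "\<dots> \<le> ?q ^ card J * ((?q - card K) * rm_bound ?q (d - card K))"
      by (intro mult_le_mono2 rm_bound_step Kd Kq)
    also have "\<dots> = (\<Sum>c\<in>-K. ?q ^ card J * rm_bound ?q (d - card K))"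
      by (simp add: Compl_eq_Diff_UNIV card_Diff_subset)
    also have "\<dots> \<le> (\<Sum>c\<in>-K. card (nonzeros f J (u(i := c))) * ?q\<^sup>2)"
      by (intro sum_mono slice)
    also have "\<dots> = card (\<Union>c\<in>-K. nonzeros f J (u(i := c))) * ?q\<^sup>2"
      by (subst card_UN_disjoint) (auto simp: nonzeros_def sum_distrib_right dest: at_i)
    also have "\<dots> \<le> card (nonzeros f (insert i J) u) * ?q\<^sup>2"
      using sub by (intro mult_le_mono1 card_mono) (auto simp: nonzeros_def)
    finally show ?case .
  qed
qed

section \<open>Points and hyperplanes in homogeneous coordinates\<close>

lemma hyperplane_normal:
  fixes W :: "('a::field ^ 'm::finite) set"
  assumes W: "vec.subspace W" and dim: "vec.dim W + 1 = CARD('m)"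
  obtains w :: "'m \<Rightarrow> 'a" where "\<And>v. v \<in> W \<longleftrightarrow> (\<Sum>i\<in>UNIV. w i * v $ i) = 0"
proof -
  obtain B where B: "B \<subseteq> W" "vec.independent B" "W \<subseteq> vec.span B" "card B = vec.dim W"
    using vec.basis_exists[of W] by metis
  have spanB: "vec.span B = W"
    using B W by (meson subset_antisym vec.span_minimal)
  have "W \<noteq> UNIV" using dim vec.dim_UNIV by (auto simp: vec.dimension_def card_cart_basis)
  then obtain b where b: "b \<notin> vec.span B" using spanB by auto
  have ind: "vec.independent (insert b B)"
    using B b by (simp add: vec.independent_insertI)
  have "b \<notin> B" using b vec.span_base by auto
  moreover have "finite B" using vec.indep_card_eq_dim_span[OF B(2)] by blast
  ultimately have "card (insert b B) = CARD('m)" using B(4) dim by simp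
  then have span: "vec.span (insert b B) = UNIV"
    using vec.card_eq_dim[of "insert b B" UNIV, unfolded vec_dim_card] ind
      vec.indep_card_eq_dim_span[OF ind] by (metis UNIV_I subset_UNIV subset_antisym)
  \<comment> \<open>The basis of \<open>W\<close> goes to 0 and the additional vector
    \<open>b\<close> to the all-ones vector. Hence each coordinate of \<open>f\<close> is a
    functional with kernel \<open>W\<close>, and any row of its matrix serves as a normal
    vector.\<close>
  obtain f where f: "Vector_Spaces.linear (*s) (*s) f"
    and fB: "\<And>x. x \<in> insert b B \<Longrightarrow> f x = (if x = b then 1 else 0 :: 'a ^ 'm)"
    using vec.linear_independent_extend[OF ind, of "\<lambda>x. if x = b then 1 else 0"] by blast
  interpret f: Vector_Spaces.linear "(*s)" "(*s)" f by (rule f)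
  have fW: "f v = 0" if "v \<in> W" for v
    using f.eq_0_on_span[of B v] that spanB fB \<open>b \<notin> B\<close> by (metis insertCI)
  obtain k :: 'm where True by blast
  have "v \<in> W \<longleftrightarrow> f v $ k = 0" for v
  proof -
    obtain t where t: "v - t *s b \<in> W"
      using span vec.span_breakdown_eq[of v b B] spanB by auto
    then have "f v - t *s f b = 0"
      using fW[OF t] by (simp add: f.diff f.scale)
    then have ft: "f v $ k = t" using fB[of b] by (simp add: vec_eq_iff)
    show ?thesis
    proof
      assume "f v $ k = 0"
      then show "v \<in> W" using t ft by simp
    qed (simp add: fW)
  qed
  moreover have "f v $ k = (\<Sum>i\<in>UNIV. matrix f $ k $ i * v $ i)" for v
    by (subst matrix_works[OF f, symmetric]) (simp add: matrix_vector_mult_def)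
  ultimately show thesis
    using that[of "\<lambda>i. matrix f $ k $ i"] by simp
qed

lemma span_mem_pg_points:
  fixes v :: "'a::field ^ 'm::finite"
  assumes "v \<noteq> 0"
  shows "vec.span {v} \<in> pg_points"
  using assms by (simp add: pg_points_def vec.dim_span_eq_card_independent vec.subspace_span
      vec.dim_eq_card_independent)

lemma pg_pointE:
  fixes P :: "('a::field ^ 'm::finite) set"
  assumes "P \<in> pg_points"
  obtains v where "v \<noteq> 0" "P = vec.span {v}"
proof -
  have P: "vec.subspace P" "vec.dim P = 1" using assms by (auto simp: pg_points_def)
  obtain B where B: "B \<subseteq> P" "vec.independent B" "P \<subseteq> vec.span B" "card B = 1"
    using vec.basis_exists[of P] P(2) by metis
  then obtain v where v: "B = {v}" by (auto simp: card_1_singleton_iff)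
  have "P = vec.span {v}"
    using B v P(1) by (metis subset_antisym vec.span_minimal)
  moreover have "v \<noteq> 0" using B(2) v by simp
  ultimately show thesis using that by blast
qed

lemma pg_hyperplane_normal:
  fixes H :: "('a::field ^ 'm::finite) set set"
  assumes "H \<in> pg_hyperplanes"
  shows "\<exists>w. \<forall>v. v \<noteq> 0 \<longrightarrow> (vec.span {v} \<in> H \<longleftrightarrow> (\<Sum>i\<in>UNIV. w i * v $ i) = 0)"
proof -
  obtain W :: "('a ^ 'm) set" where W: "vec.subspace W" "vec.dim W + 1 = CARD('m)"
    and H: "H = {P \<in> pg_points. P \<subseteq> W}"
    using assms by (auto simp: pg_hyperplanes_def)
  obtain w where w: "\<And>v. v \<in> W \<longleftrightarrow> (\<Sum>i\<in>UNIV. w i * v $ i) = 0"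
    using hyperplane_normal[OF W] by blast
  have "vec.span {v} \<subseteq> W \<longleftrightarrow> v \<in> W" for v
    using W(1) by (metis empty_subsetI insert_subset vec.span_base insertI1 subsetD vec.span_minimal)
  then show ?thesis
    using w H span_mem_pg_points by (intro exI[of _ w]) auto
qed

section \<open>An affine chart for the complement of a hyperplane\<close>

text \<open>
  Parametrises the affine hyperplane where the linear form with coefficients \<open>w\<close> equals 1; the
  coordinate \<open>x i\<close> is ignored.
\<close>

definition chart :: "('m::finite \<Rightarrow> 'a::field) \<Rightarrow> 'm \<Rightarrow> ('m \<Rightarrow> 'a) \<Rightarrow> 'a ^ 'm" where
  "chart w i x = (\<chi> j. if j = i then (1 - (\<Sum>k\<in>UNIV - {i}. w k * x k)) / w i else x j)"

lemma sum_chart: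
  "(\<Sum>j\<in>UNIV. w' j * chart w i x $ j) =
    w' i * ((1 - (\<Sum>k\<in>UNIV - {i}. w k * x k)) / w i) + (\<Sum>j\<in>UNIV - {i}. w' j * x j)"
  by (simp add: sum.remove[of UNIV i] chart_def)

lemma sum_chart_self: "w i \<noteq> 0 \<Longrightarrow> (\<Sum>j\<in>UNIV. w j * chart w i x $ j) = 1"
  by (simp add: sum_chart)

text \<open>Coordinate \<open>i\<close> of the chart is affine in the others; substituting it leaves
  the coefficients \<open>?u\<close>, with 0 at the ignored coordinate.\<close>

lemma affine_fun_chart: "affine_fun (\<lambda>x. \<Sum>j\<in>UNIV. w' j * chart w i x $ j)"
proof -
  let ?u = "\<lambda>j. if j = i then 0 else w' j - w' i / w i * w j"
  have "(\<Sum>j\<in>UNIV. w' j * chart w i x $ j) = w' i / w i + (\<Sum>j\<in>UNIV. ?u j * x j)" for x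
  proof -
    have "(\<Sum>j\<in>UNIV. ?u j * x j) = (\<Sum>j\<in>UNIV - {i}. w' j * x j - w' i / w i * (w j * x j))"
      by (simp add: sum.remove[of UNIV i] algebra_simps)
    also have "\<dots> = (\<Sum>j\<in>UNIV - {i}. w' j * x j) - w' i / w i * (\<Sum>j\<in>UNIV - {i}. w j * x j)"
      by (simp add: sum_subtractf sum_distrib_left)
    finally show ?thesis
      unfolding sum_chart by (simp add: diff_divide_distrib right_diff_distrib)
  qed
  then show ?thesis unfolding affine_fun_def by (intro exI allI)
qed

text \<open>The preimage has 0 at the ignored coordinate, which places it in the flat on which
  nonzeros are counted later.\<close>

lemma chart_surj:
  assumes "w i \<noteq> 0" and "(\<Sum>j\<in>UNIV. w j * v $ j) = 1"
  shows "chart w i (\<lambda>j. if j = i then 0 else v $ j) = v"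
proof -
  have "1 - (\<Sum>k\<in>UNIV - {i}. w k * v $ k) = w i * v $ i"
    using assms(2) by (simp add: sum.remove[of UNIV i] algebra_simps)
  moreover have "(\<Sum>k\<in>UNIV - {i}. w k * (if k = i then 0 else v $ k)) = (\<Sum>k\<in>UNIV - {i}. w k * v $ k)"
    by (intro sum.cong) auto
  ultimately show ?thesis
    using assms(1) by (simp add: chart_def vec_eq_iff)
qed

lemma inj_on_chart: "inj_on (chart w i) (coord_flat (UNIV - {i}) u)"
proof (rule inj_onI, rule ext)
  fix x y j
  assume "x \<in> coord_flat (UNIV - {i}) u" "y \<in> coord_flat (UNIV - {i}) u" "chart w i x = chart w i y"
  then show "x j = y j"
    by (cases "j = i") (auto simp: coord_flat_def chart_def vec_eq_iff dest: spec[of _ j])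
qed

section \<open>Counting holes in the chart off one hyperplane of the cover\<close>

theorem corollary6p6:
  fixes C :: "('a::{field,finite} ^ 'm::finite) set set set"
    and q n a :: nat
  assumes "CARD('a) = q"
    and "n \<ge> 1"
    and "CARD('m) = n + 1"
    and "a < q"
    and "partial_cover C"
    and "card C = q + a"
  shows "real (card (holes C)) \<ge> real q powi (int n - 1) - real a * real q powi (int n - 2)"
proof -
  have q: "q > 0" using assms(4) by simp
  have C: "C \<subseteq> pg_hyperplanes" "\<Union>C \<noteq> pg_points"
    using assms(5) by (auto simp: partial_cover_def)
  have "\<Union>C \<subseteq> pg_points" using C(1) by (auto simp: pg_hyperplanes_def)
  then obtain P where P: "P \<in> pg_points" "P \<notin> \<Union>C" using C(2) by blast
  obtain p where p: "p \<noteq> 0" "P = vec.span {p}" using pg_pointE[OF P(1)] .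
  have "\<forall>H\<in>C. \<exists>w. \<forall>v. v \<noteq> 0 \<longrightarrow> (vec.span {v} \<in> H \<longleftrightarrow> (\<Sum>i\<in>UNIV. w i * v $ i) = 0)"
    using C(1) pg_hyperplane_normal by blast
  then obtain w where w: "\<And>H v. H \<in> C \<Longrightarrow> v \<noteq> 0 \<Longrightarrow>
      vec.span {v} \<in> H \<longleftrightarrow> (\<Sum>i\<in>UNIV. w H i * v $ i) = 0"
    by metis
  have p_off: "(\<Sum>i\<in>UNIV. w H i * p $ i) \<noteq> 0" if "H \<in> C" for H
    using w[OF that p(1)] P(2) p(2) that by blast
  have "C \<noteq> {}" using assms(6) q by auto
  then obtain H0 where H0: "H0 \<in> C" by blast
  have "\<exists>i. w H0 i \<noteq> 0"
  proof (rule ccontr)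
    assume "\<nexists>i. w H0 i \<noteq> 0"
    then show False using p_off[OF H0] by simp
  qed
  then obtain i where i: "w H0 i \<noteq> 0" by blast
  let ?\<phi> = "chart (w H0) i"
  define f where "f x = (\<Prod>H\<in>C - {H0}. \<Sum>j\<in>UNIV. w H j * ?\<phi> x $ j)" for x
  \<comment> \<open>The bound of \<open>deg_less\<close> is strict, so \<open>q + a - 1\<close>
    factors give \<open>q + a\<close>.\<close>
  have "Suc (card (C - {H0})) = q + a" using H0 assms(6) q by simp
  then have deg: "deg_less (q + a) f"
    using deg_less_prod[of "C - {H0}" "\<lambda>H x. \<Sum>j\<in>UNIV. w H j * ?\<phi> x $ j",
        OF finite affine_fun_chart]
    unfolding f_def[abs_def] by simp
  let ?N = "nonzeros f (UNIV - {i}) (\<lambda>_. 0)"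
  define s where "s = (\<Sum>j\<in>UNIV. w H0 j * p $ j)"
  have s: "s \<noteq> 0" using p_off[OF H0] by (simp add: s_def)
  \<comment> \<open>The hole \<open>P\<close> is rescaled into the chart, where it gives a point
    with \<open>f\<close> nonzero.\<close>
  define v where "v = inverse s *s p"
  have wv: "(\<Sum>j\<in>UNIV. w H j * v $ j) = inverse s * (\<Sum>j\<in>UNIV. w H j * p $ j)" for H
    by (simp add: v_def sum_distrib_left mult_ac)
  have "(\<Sum>j\<in>UNIV. w H0 j * v $ j) = 1"
    using s unfolding wv by (simp flip: s_def)
  then have "?\<phi> (\<lambda>j. if j = i then 0 else v $ j) = v"
    by (rule chart_surj[of "w H0", OF i])
  then have "(\<lambda>j. if j = i then 0 else v $ j) \<in> ?N"
    using p_off s wv by (simp add: nonzeros_def coord_flat_def f_def)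
  then have "?N \<noteq> {}" by blast
  from nonzeros_lower_bound[OF deg this]
  \<comment> \<open>Both branches of \<open>rm_bound\<close> give \<open>q - a\<close> at
    \<open>q + a\<close>; the first occurs exactly for \<open>a = 0\<close>.\<close>
  have N: "q ^ n * (q - a) \<le> card ?N * q\<^sup>2"
    using assms(1,3,4) by (auto simp: rm_bound_def card_Diff_singleton split: if_splits)
  have chart_1: "(\<Sum>j\<in>UNIV. w H0 j * ?\<phi> x $ j) = 1" for x
    by (rule sum_chart_self[of "w H0", OF i])
  have \<phi>_ne: "?\<phi> x \<noteq> 0" for x
    using chart_1[of x] by auto
  \<comment> \<open>Proportional vectors on which the form of \<open>H0\<close> takes the value 1
    are equal.\<close>
  have "inj_on (\<lambda>x. vec.span {?\<phi> x}) ?N"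
  proof (rule inj_onI)
    fix x y assume xy: "x \<in> ?N" "y \<in> ?N" "vec.span {?\<phi> x} = vec.span {?\<phi> y}"
    then have "?\<phi> x \<in> vec.span {?\<phi> y}" by (metis insertI1 vec.span_base)
    then obtain k where k: "?\<phi> x = k *s ?\<phi> y" by (auto simp: vec.span_singleton)
    have "1 = k * (\<Sum>j\<in>UNIV. w H0 j * ?\<phi> y $ j)"
      using chart_1[of x] k by (simp add: sum_distrib_left mult_ac)
    then have "k = 1" using chart_1[of y] by simp
    then have "?\<phi> x = ?\<phi> y" using k by simp
    then show "x = y"
      using inj_on_chart[of "w H0" i "\<lambda>_. 0"] xy by (auto simp: nonzeros_def dest: inj_onD)
  qed
  moreover have "(\<lambda>x. vec.span {?\<phi> x}) ` ?N \<subseteq> holes C"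
  proof (rule image_subsetI)
    fix x assume "x \<in> ?N"
    then have "(\<Sum>j\<in>UNIV. w H j * ?\<phi> x $ j) \<noteq> 0" if "H \<in> C" for H
      using that chart_1[of x] by (cases "H = H0") (auto simp: nonzeros_def f_def)
    then have "vec.span {?\<phi> x} \<notin> \<Union>C" using w \<phi>_ne by blast
    then show "vec.span {?\<phi> x} \<in> holes C"
      using span_mem_pg_points[OF \<phi>_ne] by (simp add: holes_def)
  qed
  ultimately have "card ?N \<le> card (holes C)"
    by (intro card_inj_on_le) auto
  then have "q ^ n * (q - a) \<le> card (holes C) * q\<^sup>2"
    using N by (meson le_trans mult_le_mono1)
  then have "real (q ^ n * (q - a)) \<le> real (card (holes C) * q\<^sup>2)"
    by (rule of_nat_mono)
  then have "real q ^ n * (real q - real a) / (real q)\<^sup>2 \<le> real (card (holes C))"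
    using assms(4) q by (simp add: of_nat_diff divide_simps)
  \<comment> \<open>For \<open>n = 1\<close> the exponent \<open>n - 2\<close> is negative, hence
    the quotients by the square of \<open>q\<close>.\<close>
  moreover have "real q powi (int n - 1) = real q ^ n * real q / (real q)\<^sup>2"
    "real q powi (int n - 2) = real q ^ n / (real q)\<^sup>2"
    using q by (simp_all add: power_int_diff power2_eq_square)
  ultimately show ?thesis
    by (simp add: diff_divide_distrib algebra_simps)
qed

end
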